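(* Let $n\ge1$, $\lambda,\mu\vdash n$, and let $D$ be a non-empty set of perfect matchings of $K_{2n}$ that is a $\lambda$-factorisation. If $\lambda\trianglelefteq\mu$ ($\mu$ dominates $\lambda$), then $D$ is also a $\mu$-factorisation.
   Context: A perfect matching of $K_{2n}$ is a set partition of $\{1,\dots,2n\}$ into pairs. For $\lambda\vdash n$, a set partition of $\{1,\dots,2n\}$ has shape $2\lambda$ if its block sizes are $2\lambda_1,2\lambda_2,\dots$. A non-empty set $D$ of perfect matchings is a $\lambda$-factorisation if there is a constant $c$ (the index) such that for every set partition $P$ of shape $2\lambda$ exactly $c$ matchings in $D$ refine $P$ (each edge lies within a block of $P$). Dominance order: $\lambda\trianglelefteq\mu$ iff $\sum_{i=1}^k\lambda_i\le\sum_{i=1}^k\mu_i$ for all $k\ge1$. *)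

theory Defs
  imports "HOL-Library.Disjoint_Sets" "HOL-Library.Multiset"
begin

(* An integer partition is the list of its parts, positive and in weakly decreasing order. *)
definition int_partition :: "nat \<Rightarrow> nat list \<Rightarrow> bool" where
  "int_partition n l \<longleftrightarrow> sorted_wrt (\<ge>) l \<and> 0 \<notin> set l \<and> sum_list l = n"

(* For k beyond the length of a list, take k returns the whole list, which agrees
   with the convention that the missing parts are 0. *)
definition dominated_by :: "nat list \<Rightarrow> nat list \<Rightarrow> bool" where
  "dominated_by l m \<longleftrightarrow> (\<forall>k\<ge>1. sum_list (take k l) \<le> sum_list (take k m))"

definition perfect_matchings :: "nat \<Rightarrow> nat set set set" where
  "perfect_matchings n = {M. partition_on {1..2 * n} M \<and> (\<forall>e\<in>M. card e = 2)}"

definition has_double_shape :: "nat \<Rightarrow> nat list \<Rightarrow> nat set set \<Rightarrow> bool" where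
  "has_double_shape n l P \<longleftrightarrow>
     partition_on {1..2 * n} P \<and> image_mset card (mset_set P) = mset (map (\<lambda>i. 2 * i) l)"

definition factorisation :: "nat \<Rightarrow> nat list \<Rightarrow> nat set set set \<Rightarrow> bool" where
  "factorisation n l D \<longleftrightarrow>
     D \<noteq> {} \<and> D \<subseteq> perfect_matchings n \<and>
     (\<exists>c. \<forall>P. has_double_shape n l P \<longrightarrow> card {M \<in> D. refines {1..2 * n} M P} = c)"

end

theory Submission
  imports Defs "HOL-Library.More_List"
begin

text \<open>
  Dominance is generated by moving one unit from a part to one at least as large, so only two blocks
  change and one may work inside their union \<open>S\<close>. For \<open>A \<subseteq> S\<close> let \<open>f A\<close> be the number of
  matchings, among those compatible with the other blocks and with \<open>S\<close>, for which \<open>A\<close> is a union of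
  edges. If \<open>|S| = 2N\<close>, \<open>2b \<le> N\<close> and \<open>|A| = 2i \<le> 2b\<close>, then summing \<open>f\<close> over all sets of size
  \<open>2b\<close> containing \<open>A\<close> and applying Vandermonde's identity to each matching yields
  the sum over \<open>j \<le> i\<close> of \<open>(N - 2i) choose (N - b - j)\<close> times the total of \<open>f\<close> over the
  \<open>2j\<close>-subsets of \<open>A\<close>; the term \<open>j = i\<close> is a positive multiple of \<open>f A\<close>. Hence, by induction on \<open>i\<close>, if \<open>f\<close> is constant on sets of size \<open>2b\<close>, it is constant on sets of
  each smaller even size; double counting shows that the constant does not depend on the other blocks.
  Blocks are labelled by colouring the vertices, which allows empty blocks and parts in any order.
\<close>

section \<open>Perfect matchings of an arbitrary vertex set and unions of their edges\<close>

definition pairing_on :: "'a set \<Rightarrow> 'a set set \<Rightarrow> bool" where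
  "pairing_on S E \<longleftrightarrow> partition_on S E \<and> (\<forall>e\<in>E. card e = 2)"

definition edge_closed :: "'a set set \<Rightarrow> 'a set \<Rightarrow> bool" where
  "edge_closed E A \<longleftrightarrow> (\<forall>e\<in>E. e \<subseteq> A \<or> e \<inter> A = {})"

lemma pairing_onD:
  assumes "pairing_on S E"
  shows "\<Union>E = S" "disjoint E" "e \<in> E \<Longrightarrow> card e = 2" "e \<in> E \<Longrightarrow> finite e" "e \<in> E \<Longrightarrow> e \<noteq> {}"
  using assms by (auto simp: pairing_on_def partition_on_def intro: card_ge_0_finite)

lemma finite_pairing: "finite S \<Longrightarrow> pairing_on S E \<Longrightarrow> finite E"
  by (auto simp: pairing_on_def intro: finite_elements)

lemma card_Union_pairing:
  assumes "pairing_on S E" "X \<subseteq> E"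
  shows "card (\<Union>X) = 2 * card X"
proof -
  have "card (\<Union>X) = sum card X"
    using assms(2) pairing_onD(2,4)[OF assms(1)]
    by (intro card_Union_disjoint pairwise_subset[of disjnt E X])
      (auto simp: disjoint_def pairwise_def disjnt_def)
  also have "\<dots> = sum (\<lambda>_. 2) X"
    using assms pairing_onD(3)[OF assms(1)] by (intro sum.cong) auto
  finally show ?thesis by simp
qed

lemma card_pairing: "pairing_on S E \<Longrightarrow> card S = 2 * card E"
  using card_Union_pairing[of S E E] pairing_onD(1) by fastforce

text \<open>Edges are non-empty and disjoint, so a union of edges determines which edges were used.
  Counting closed vertex sets thereby becomes counting sets of edges.\<close>

lemma bij_betw_Union_edge_closed:
  assumes "pairing_on S E"
  shows "bij_betw Union (Pow E) {B. B \<subseteq> S \<and> edge_closed E B}"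
proof (rule bij_betw_byWitness[where f' = "\<lambda>B. {e \<in> E. e \<subseteq> B}"])
  note E = pairing_onD[OF assms]
  have disj: "e = e'" if "e \<in> E" "e' \<in> E" "x \<in> e" "x \<in> e'" for e e' x
    using E(2) that by (auto simp: disjoint_def)
  show "\<forall>X\<in>Pow E. {e \<in> E. e \<subseteq> \<Union>X} = X"
  proof (intro ballI set_eqI iffI)
    fix X e assume X: "X \<in> Pow E" and e: "e \<in> {e \<in> E. e \<subseteq> \<Union>X}"
    then obtain x where "x \<in> e" using E(5) by blast
    with X e show "e \<in> X" using disj by blast
  qed auto
  show "\<forall>B\<in>{B. B \<subseteq> S \<and> edge_closed E B}. \<Union>{e \<in> E. e \<subseteq> B} = B"
  proof (intro ballI equalityI subsetI)
    fix B x assume B: "B \<in> {B. B \<subseteq> S \<and> edge_closed E B}" and x: "x \<in> B"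
    then obtain e where "e \<in> E" "x \<in> e" using E(1) by blast
    with B x show "x \<in> \<Union>{e \<in> E. e \<subseteq> B}" unfolding edge_closed_def by blast
  qed auto
  show "Union ` Pow E \<subseteq> {B. B \<subseteq> S \<and> edge_closed E B}"
  proof (clarsimp, intro conjI)
    fix X assume "X \<subseteq> E"
    then show "\<Union>X \<subseteq> S" using E(1) by blast
    show "edge_closed E (\<Union>X)"
      unfolding edge_closed_def
    proof
      fix e assume "e \<in> E"
      show "e \<subseteq> \<Union>X \<or> e \<inter> \<Union>X = {}"
      proof (cases "e \<in> X")
        case False
        with \<open>X \<subseteq> E\<close> disj[OF \<open>e \<in> E\<close>] show ?thesis by blast
      qed auto
    qed
  qed
  show "(\<lambda>B. {e \<in> E. e \<subseteq> B}) ` {B. B \<subseteq> S \<and> edge_closed E B} \<subseteq> Pow E"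
    by auto
qed

text \<open>The side condition \<open>Q\<close> lets one transfer serve both the subsets and the
  supersets of a fixed \<open>A\<close>.\<close>

lemma card_edge_closed:
  assumes "pairing_on S E"
  shows "card {B. B \<subseteq> S \<and> edge_closed E B \<and> card B = 2 * b \<and> Q B}
       = card {X. X \<subseteq> E \<and> card X = b \<and> Q (\<Union>X)}"
proof -
  have "bij_betw Union {X \<in> Pow E. card X = b \<and> Q (\<Union>X)}
     {B \<in> {B. B \<subseteq> S \<and> edge_closed E B}. card B = 2 * b \<and> Q B}"
    by (rule bij_betw_Collect[OF bij_betw_Union_edge_closed[OF assms]])
      (use card_Union_pairing[OF assms] in auto)
  from bij_betw_same_card[OF this] show ?thesis by (simp add: conj_ac)
qed

lemma card_edge_closed_subsets:
  assumes "finite S" "pairing_on S E" "A \<subseteq> S"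
  shows "card {C. C \<subseteq> A \<and> card C = 2 * j \<and> edge_closed E C} = card {e \<in> E. e \<subseteq> A} choose j"
proof -
  have "{C. C \<subseteq> A \<and> card C = 2 * j \<and> edge_closed E C}
      = {B. B \<subseteq> S \<and> edge_closed E B \<and> card B = 2 * j \<and> B \<subseteq> A}"
    using assms by auto
  also have "card \<dots> = card {X. X \<subseteq> E \<and> card X = j \<and> \<Union>X \<subseteq> A}"
    by (rule card_edge_closed[OF assms(2)])
  also have "{X. X \<subseteq> E \<and> card X = j \<and> \<Union>X \<subseteq> A} = {X. X \<subseteq> {e \<in> E. e \<subseteq> A} \<and> card X = j}"
    by auto
  finally show ?thesis using finite_pairing[OF assms(1,2)] by (simp add: n_subsets)
qed

text \<open>Complementation in \<open>E\<close>. Choosing the omitted elements keeps the formula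
  right when \<open>b < card T\<close>: the binomial is then 0, whereas a lower index
  \<open>b - card T\<close> would truncate to 0 and give 1.\<close>

lemma card_supersets:
  assumes "finite E" "T \<subseteq> E" "b \<le> card E"
  shows "card {X. X \<subseteq> E \<and> card X = b \<and> T \<subseteq> X} = (card E - card T) choose (card E - b)"
proof -
  have "bij_betw (\<lambda>X. E - X) {X. X \<subseteq> E \<and> card X = b \<and> T \<subseteq> X}
      {Y. Y \<subseteq> E - T \<and> card Y = card E - b}"
  proof (rule bij_betw_byWitness[where f' = "\<lambda>X. E - X"])
    have card_Diff: "card (E - X) = card E - card X" if "X \<subseteq> E" for X
      using that assms(1) by (simp add: card_Diff_subset finite_subset)
    show "(\<lambda>X. E - X) ` {X. X \<subseteq> E \<and> card X = b \<and> T \<subseteq> X}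
        \<subseteq> {Y. Y \<subseteq> E - T \<and> card Y = card E - b}"
      using card_Diff by auto
    show "(\<lambda>X. E - X) ` {Y. Y \<subseteq> E - T \<and> card Y = card E - b}
        \<subseteq> {X. X \<subseteq> E \<and> card X = b \<and> T \<subseteq> X}"
    proof
      fix X assume "X \<in> (\<lambda>X. E - X) ` {Y. Y \<subseteq> E - T \<and> card Y = card E - b}"
      then obtain Y where Y: "X = E - Y" "Y \<subseteq> E - T" "card Y = card E - b" by blast
      then have "card X = b" using card_Diff[of Y] assms(3) by auto
      with Y assms(2) show "X \<in> {X. X \<subseteq> E \<and> card X = b \<and> T \<subseteq> X}" by blast
    qed
  qed auto
  from bij_betw_same_card[OF this] show ?thesis
    using assms by (simp add: n_subsets card_Diff_subset finite_subset)
qed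

text \<open>An edge meets \<open>A\<close> in 0, 1 or 2 vertices: one is counted for touching
  \<open>A\<close>, a second for lying inside.\<close>

lemma card_touched_edges:
  assumes "finite S" "pairing_on S E" "A \<subseteq> S"
  shows "card {e \<in> E. e \<inter> A \<noteq> {}} + card {e \<in> E. e \<subseteq> A} = card A"
proof -
  note E = pairing_onD[OF assms(2)] and fin = finite_pairing[OF assms(1,2)]
  have "card A = card (\<Union>e\<in>E. e \<inter> A)"
    using E(1) assms(3) by (intro arg_cong[where f = card]) auto
  also have "\<dots> = (\<Sum>e\<in>E. card (e \<inter> A))"
    using E(2,4) fin by (intro card_UN_disjoint) (auto simp: disjoint_def)
  also have "\<dots> = (\<Sum>e\<in>E. of_bool (e \<inter> A \<noteq> {}) + of_bool (e \<subseteq> A))"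
  proof (rule sum.cong[OF refl])
    fix e assume e: "e \<in> E"
    then obtain u v where "e = {u, v}" "u \<noteq> v" using E(3)[OF e] by (auto simp: card_2_iff)
    then show "card (e \<inter> A) = of_bool (e \<inter> A \<noteq> {}) + of_bool (e \<subseteq> A)"
      by (cases "u \<in> A"; cases "v \<in> A") auto
  qed
  finally show ?thesis using fin by (simp add: sum.distrib Int_def)
qed

text \<open>A set of edges covers \<open>A\<close> exactly when it contains every edge touching
  \<open>A\<close>, so the omitted edges are chosen freely among the untouched ones. With
  \<open>p\<close> edges inside \<open>A\<close> there are \<open>p + (card E - 2 * i)\<close> of
  these; Vandermonde separates \<open>p\<close>, the only quantity that varies with the
  matching.\<close>

lemma card_edge_closed_supersets:
  assumes "finite S" "pairing_on S E" "A \<subseteq> S" "card A = 2 * i" "2 * i \<le> card E" "b \<le> card E"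
  shows "card {B. A \<subseteq> B \<and> B \<subseteq> S \<and> card B = 2 * b \<and> edge_closed E B}
       = (\<Sum>j\<le>card E - b. (card {e \<in> E. e \<subseteq> A} choose j) * ((card E - 2 * i) choose (card E - b - j)))"
proof -
  let ?T = "{e \<in> E. e \<inter> A \<noteq> {}}" and ?p = "card {e \<in> E. e \<subseteq> A}"
  note E = pairing_onD[OF assms(2)] and fin = finite_pairing[OF assms(1,2)]
  have "{B. A \<subseteq> B \<and> B \<subseteq> S \<and> card B = 2 * b \<and> edge_closed E B}
      = {B. B \<subseteq> S \<and> edge_closed E B \<and> card B = 2 * b \<and> A \<subseteq> B}"
    by auto
  also have "card \<dots> = card {X. X \<subseteq> E \<and> card X = b \<and> A \<subseteq> \<Union>X}"
    by (rule card_edge_closed[OF assms(2)])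
  also have "{X. X \<subseteq> E \<and> card X = b \<and> A \<subseteq> \<Union>X} = {X. X \<subseteq> E \<and> card X = b \<and> ?T \<subseteq> X}"
  proof -
    have "A \<subseteq> \<Union>X \<longleftrightarrow> ?T \<subseteq> X" if X: "X \<subseteq> E" for X
    proof
      assume *: "A \<subseteq> \<Union>X"
      show "?T \<subseteq> X"
      proof
        fix e assume "e \<in> ?T"
        then obtain x where x: "e \<in> E" "x \<in> e" "x \<in> A" by auto
        with * obtain e' where "e' \<in> X" "x \<in> e'" by auto
        with x X E(2) have "e = e'" by (auto simp: disjoint_def)
        with \<open>e' \<in> X\<close> show "e \<in> X" by simp
      qed
    next
      assume *: "?T \<subseteq> X"
      show "A \<subseteq> \<Union>X"
      proof
        fix x assume x: "x \<in> A"
        then obtain e where "e \<in> E" "x \<in> e" using assms(3) E(1) by auto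
        with x * show "x \<in> \<Union>X" by auto
      qed
    qed
    then show ?thesis by auto
  qed
  also have "card \<dots> = (card E - card ?T) choose (card E - b)"
    using fin assms(6) by (intro card_supersets) auto
  also have "card E - card ?T = ?p + (card E - 2 * i)"
  proof -
    have "card ?T \<le> card E" using fin by (intro card_mono) auto
    with card_touched_edges[OF assms(1-3)] assms(4,5) show ?thesis by linarith
  qed
  finally show ?thesis by (simp only: vandermonde)
qed

section \<open>Counting the matchings for which a subset of \<open>S\<close> is closed\<close>

context
  fixes S :: "'a set" and D :: "'i set" and E :: "'i \<Rightarrow> 'a set set" and N :: nat
  assumes finS: "finite S" and finD: "finite D" and card_S: "card S = 2 * N"
    and pairing: "\<And>m. m \<in> D \<Longrightarrow> pairing_on S (E m)"
begin

text \<open>\<open>D\<close> is an index set, not a set of pairings of \<open>S\<close>: different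
  matchings of the whole vertex set may have the same restriction to \<open>S\<close>, and each must
  be counted.\<close>

definition closed_count :: "'a set \<Rightarrow> nat" where
  "closed_count A = card {m \<in> D. edge_closed (E m) A}"

lemma card_E: "m \<in> D \<Longrightarrow> card (E m) = N"
  using card_pairing[OF pairing] card_S by fastforce

lemma sum_closed_count:
  assumes "finite F"
  shows "(\<Sum>B\<in>F. closed_count B) = (\<Sum>m\<in>D. card {B \<in> F. edge_closed (E m) B})"
  unfolding closed_count_def using assms finD by (intro sum_multicount_gen) auto

lemma sum_closed_count_subsets:
  assumes "A \<subseteq> S"
  shows "(\<Sum>C | C \<subseteq> A \<and> card C = 2 * j. closed_count C) = (\<Sum>m\<in>D. card {e \<in> E m. e \<subseteq> A} choose j)"
proof -
  have "finite {C. C \<subseteq> A \<and> card C = 2 * j}" using assms finS finite_subset by fastforce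
  then show ?thesis
    using card_edge_closed_subsets[OF finS pairing assms, of _ j]
    by (simp add: sum_closed_count conj_assoc)
qed

lemma sum_closed_count_all:
  "(\<Sum>C | C \<subseteq> S \<and> card C = 2 * j. closed_count C) = card D * (N choose j)"
proof -
  have "{e \<in> E m. e \<subseteq> S} = E m" if "m \<in> D" for m
    using pairing_onD(1)[OF pairing[OF that]] by auto
  then show ?thesis using card_E by (simp add: sum_closed_count_subsets)
qed

text \<open>Apply the count for a single matching to each \<open>m\<close> and exchange the sums.
  The weights depend only on \<open>N\<close>, \<open>b\<close>, \<open>i\<close> and
  \<open>j\<close>, so a linear relation between values of \<open>closed_count\<close>
  remains.\<close>

lemma sum_closed_count_supersets:
  assumes "A \<subseteq> S" "card A = 2 * i" "i \<le> b" "2 * b \<le> N"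
  shows "(\<Sum>B | A \<subseteq> B \<and> B \<subseteq> S \<and> card B = 2 * b. closed_count B)
    = (\<Sum>j\<le>N - b. ((N - 2 * i) choose (N - b - j)) * (\<Sum>C | C \<subseteq> A \<and> card C = 2 * j. closed_count C))"
proof -
  have "finite {B. A \<subseteq> B \<and> B \<subseteq> S \<and> card B = 2 * b}" using finS by simp
  then have "(\<Sum>B | A \<subseteq> B \<and> B \<subseteq> S \<and> card B = 2 * b. closed_count B)
    = (\<Sum>m\<in>D. \<Sum>j\<le>N - b. (card {e \<in> E m. e \<subseteq> A} choose j) * ((N - 2 * i) choose (N - b - j)))"
    using card_edge_closed_supersets[OF finS pairing assms(1,2), of _ b] card_E assms
    by (simp add: sum_closed_count conj_assoc)
  also have "\<dots> = (\<Sum>j\<le>N - b. ((N - 2 * i) choose (N - b - j)) * (\<Sum>m\<in>D. card {e \<in> E m. e \<subseteq> A} choose j))"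
    by (subst sum.swap) (simp add: sum_distrib_left mult.commute)
  finally show ?thesis by (simp add: sum_closed_count_subsets[OF assms(1)])
qed

text \<open>The superset sum is the same for all \<open>A\<close> of size \<open>2 * i\<close>. In
  its expansion the terms with \<open>j < i\<close> agree by induction and those with
  \<open>j > i\<close> vanish, so the terms with \<open>j = i\<close> agree too.\<close>

lemma closed_count_const:
  assumes const: "\<And>B. B \<subseteq> S \<Longrightarrow> card B = 2 * b \<Longrightarrow> closed_count B = c"
    and "2 * b \<le> N" "i \<le> b" "A \<subseteq> S" "A' \<subseteq> S" "card A = 2 * i" "card A' = 2 * i"
  shows "closed_count A = closed_count A'"
  using assms(3-)
proof (induction i arbitrary: A A' rule: less_induct)
  case (less i)
  let ?s = "\<lambda>A j. \<Sum>C | C \<subseteq> A \<and> card C = 2 * j. closed_count C"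
  let ?w = "\<lambda>j. (N - 2 * i) choose (N - b - j)"
  have finA: "finite A" "finite A'" using less.prems finS finite_subset by blast+
  have sup: "(\<Sum>B | A \<subseteq> B \<and> B \<subseteq> S \<and> card B = 2 * b. closed_count B)
      = card {B. A \<subseteq> B \<and> B \<subseteq> S \<and> card B = 2 * b} * c" for A
    using const by simp
  have card_sup: "card {B. A \<subseteq> B \<and> B \<subseteq> S \<and> card B = 2 * b} = (2 * N - 2 * i) choose (2 * N - 2 * b)"
    if "A \<subseteq> S" "card A = 2 * i" for A
  proof -
    have "{B. A \<subseteq> B \<and> B \<subseteq> S \<and> card B = 2 * b} = {B. B \<subseteq> S \<and> card B = 2 * b \<and> A \<subseteq> B}" by auto
    then show ?thesis using card_supersets[OF finS that(1), of "2 * b"] that(2) card_S assms(2) by simp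
  qed
  have s_i: "?s A i = closed_count A" if "finite A" "card A = 2 * i" for A
  proof -
    have "{C. C \<subseteq> A \<and> card C = 2 * i} = {A}"
      using that card_subset_eq[OF that(1)] by auto
    then show ?thesis by simp
  qed
  have s_eq: "?s A j = ?s A' j" if "j \<noteq> i" for j
  proof (cases "j < i")
    case True
    show ?thesis
    \<comment> \<open>\<open>C0\<close> is sought in \<open>S\<close>, so that one reference value
      serves both \<open>A\<close> and \<open>A'\<close>; without such a set both sums would be
      empty.\<close>
    proof (cases "\<exists>C0\<subseteq>S. card C0 = 2 * j")
      case True
      then obtain C0 where C0: "C0 \<subseteq> S" "card C0 = 2 * j" by blast
      have "?s A j = ((2 * i) choose (2 * j)) * closed_count C0"
        if "A \<subseteq> S" "card A = 2 * i" "finite A" for A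
      proof -
        have "?s A j = (\<Sum>C | C \<subseteq> A \<and> card C = 2 * j. closed_count C0)"
          using less.IH[OF \<open>j < i\<close> _ _ C0(1) _ C0(2)] that \<open>j < i\<close> less.prems(1)
          by (intro sum.cong) auto
        then show ?thesis using that by (simp add: n_subsets)
      qed
      then show ?thesis using less.prems finA by simp
    next
      case False
      then have "{C. C \<subseteq> A \<and> card C = 2 * j} = {}" "{C. C \<subseteq> A' \<and> card C = 2 * j} = {}"
        using less.prems by blast+
      then show ?thesis by (simp only:)
    qed
  next
    case False
    with \<open>j \<noteq> i\<close> have "i < j" by simp
    have "{C. C \<subseteq> A \<and> card C = 2 * j} = {}" if "finite A" "card A = 2 * i" for A
      using \<open>i < j\<close> that(2) by (auto dest: card_mono[OF that(1)])
    then have "{C. C \<subseteq> A \<and> card C = 2 * j} = {}" "{C. C \<subseteq> A' \<and> card C = 2 * j} = {}"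
      using finA less.prems by blast+
    then show ?thesis by (simp only:)
  qed
  have eq: "(\<Sum>j\<le>N - b. ?w j * ?s A j) = ((2 * N - 2 * i) choose (2 * N - 2 * b)) * c"
    if "A \<subseteq> S" "card A = 2 * i" for A
    unfolding sum_closed_count_supersets[OF that less.prems(1) assms(2), symmetric] sup card_sup[OF that] ..
  have split: "(\<Sum>j\<le>N - b. ?w j * ?s A j) = ?w i * closed_count A + (\<Sum>j\<in>{..N - b} - {i}. ?w j * ?s A j)"
    if "finite A" "card A = 2 * i" for A
  proof -
    \<comment> \<open>\<open>i \<le> b\<close> and \<open>2 * b \<le> N\<close> give
      \<open>i \<le> N - b\<close>, so the term \<open>j = i\<close> does occur in the sum.\<close>
    have "i \<in> {..N - b}" using less.prems(1) assms(2) by simp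
    from sum.remove[OF finite_atMost this, of "\<lambda>j. ?w j * ?s A j"] s_i[OF that]
    show ?thesis by (simp only:)
  qed
  have "(\<Sum>j\<in>{..N - b} - {i}. ?w j * ?s A j) = (\<Sum>j\<in>{..N - b} - {i}. ?w j * ?s A' j)"
    by (rule sum.cong) (simp_all add: s_eq)
  with split[OF finA(1) less.prems(4)] split[OF finA(2) less.prems(5)]
    eq[OF less.prems(2,4)] eq[OF less.prems(3,5)]
  have "?w i * closed_count A = ?w i * closed_count A'" by linarith
  \<comment> \<open>\<open>N - b - i \<le> N - 2 * i\<close> because \<open>i \<le> b\<close>, so
    the weight can be cancelled.\<close>
  moreover have "?w i > 0" using less.prems assms(2) by (simp add: zero_less_binomial_iff)
  ultimately show ?case by simp
qed

lemma closed_count_value: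
  assumes "\<And>B. B \<subseteq> S \<Longrightarrow> card B = 2 * j \<Longrightarrow> closed_count B = c"
  shows "((2 * N) choose (2 * j)) * c = card D * (N choose j)"
  using sum_closed_count_all[of j] assms finS card_S by (simp add: n_subsets)

text \<open>In the application \<open>card D\<close> varies with the blocks outside
  \<open>S\<close>, so it must not appear in the result. The first quotient recovers it from
  \<open>c\<close>; double counting at size \<open>2 * i\<close> then gives the value. Both
  divisions are exact.\<close>

lemma closed_count_transfer:
  assumes const: "\<And>B. B \<subseteq> S \<Longrightarrow> card B = 2 * b \<Longrightarrow> closed_count B = c"
    and "2 * b \<le> N" "i \<le> b" "A \<subseteq> S" "card A = 2 * i"
  shows "closed_count A
    = ((2 * N) choose (2 * b)) * c div (N choose b) * (N choose i) div ((2 * N) choose (2 * i))"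
proof -
  have "((2 * N) choose (2 * i)) * closed_count A = card D * (N choose i)"
    using closed_count_const[OF const assms(2,3) _ assms(4) _ assms(5)]
    by (intro closed_count_value) auto
  moreover have "((2 * N) choose (2 * b)) * c = card D * (N choose b)"
    using const by (rule closed_count_value)
  moreover have "(N choose b) > 0" "((2 * N) choose (2 * i)) > 0"
    using assms(2,3) by (simp_all add: zero_less_binomial_iff)
  ultimately show ?thesis
    by (metis nonzero_mult_div_cancel_left nonzero_mult_div_cancel_right not_gr0)
qed

end

section \<open>Colourings with prescribed class sizes and the two-block move\<close>

definition monochromatic :: "'a set set \<Rightarrow> ('a \<Rightarrow> nat) \<Rightarrow> bool" where
  "monochromatic M f \<longleftrightarrow> (\<forall>e\<in>M. \<forall>u\<in>e. \<forall>v\<in>e. f u = f v)"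

definition has_fibres :: "'a set \<Rightarrow> (nat \<Rightarrow> nat) \<Rightarrow> ('a \<Rightarrow> nat) \<Rightarrow> bool" where
  "has_fibres V a f \<longleftrightarrow> (\<forall>i. card {v \<in> V. f v = i} = 2 * a i)"

definition colour_balanced :: "'a set \<Rightarrow> 'a set set set \<Rightarrow> (nat \<Rightarrow> nat) \<Rightarrow> bool" where
  "colour_balanced V D a \<longleftrightarrow> (\<exists>c. \<forall>f. has_fibres V a f \<longrightarrow> card {M \<in> D. monochromatic M f} = c)"

text \<open>Given \<open>f\<close> with the new sizes, merge its classes \<open>x\<close> and
  \<open>y\<close> into \<open>S\<close>. Splitting \<open>S\<close> so that class \<open>y\<close>
  has size \<open>2 * b\<close> restores the old sizes, where the count is \<open>c\<close>; class
  \<open>y\<close> of \<open>f\<close> is two vertices smaller. The transfer between these sizes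
  applies because \<open>a y \<le> a x\<close> means \<open>2 * b \<le> N\<close>.\<close>

lemma colour_balanced_move:
  assumes finV: "finite V" and finD: "finite D" and D: "\<And>M. M \<in> D \<Longrightarrow> pairing_on V M"
    and bal: "colour_balanced V D a"
    and xy: "x \<noteq> y" "a y \<le> a x" "0 < a y"
  shows "colour_balanced V D (a(x := a x + 1, y := a y - 1))" (is "colour_balanced V D ?a'")
proof -
  from bal obtain c where c: "\<And>f. has_fibres V a f \<Longrightarrow> card {M \<in> D. monochromatic M f} = c"
    unfolding colour_balanced_def by blast
  define N where "N = a x + a y"
  define b where "b = a y"
  have "card {M \<in> D. monochromatic M f}
      = ((2 * N) choose (2 * b)) * c div (N choose b) * (N choose (b - 1)) div ((2 * N) choose (2 * (b - 1)))"
    if f: "has_fibres V ?a' f" for f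
  proof -
    \<comment> \<open>\<open>g B\<close> merges the classes \<open>x\<close> and \<open>y\<close>
      under colour \<open>x\<close>, except that \<open>B\<close> receives colour \<open>y\<close>;
      in \<open>g {}\<close> the merged class stays whole.\<close>
    define g where "g B v = (if v \<in> B then y else if f v = y then x else f v)" for B v
    define S where "S = {v \<in> V. f v = x \<or> f v = y}"
    define D' where "D' = {M \<in> D. monochromatic M (g {})}"
    define E where "E M = {e \<in> M. e \<subseteq> S}" for M
    have finS: "finite S" using finV by (simp add: S_def)
    have fib: "card {v \<in> V. f v = i} = 2 * ?a' i" for i
      using f by (auto simp: has_fibres_def)
    have "S = {v \<in> V. f v = x} \<union> {v \<in> V. f v = y}" by (auto simp: S_def)
    then have "card S = card {v \<in> V. f v = x} + card {v \<in> V. f v = y}"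
      using finV xy(1) by (simp add: card_Un_disjoint disjoint_iff)
    then have cS: "card S = 2 * N" using fib[of x] fib[of y] xy by (simp add: N_def)
    have g_x: "g {} v = x \<longleftrightarrow> v \<in> S" if "v \<in> V" for v
      using that xy(1) by (auto simp: g_def S_def)
    have D'_S: "edge_closed M S" if "M \<in> D'" for M
    proof -
      have M: "pairing_on V M" "monochromatic M (g {})" using that D unfolding D'_def by blast+
      show ?thesis unfolding edge_closed_def
      proof
        fix e assume "e \<in> M"
        then have "e \<subseteq> V" and eq: "\<And>u v. u \<in> e \<Longrightarrow> v \<in> e \<Longrightarrow> g {} u = g {} v"
          using M(2) pairing_onD(1)[OF M(1)] unfolding monochromatic_def by blast+
        show "e \<subseteq> S \<or> e \<inter> S = {}"
        proof (rule disjCI)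
          assume "e \<inter> S \<noteq> {}"
          then obtain u where "u \<in> e" "u \<in> S" by blast
          then show "e \<subseteq> S" using \<open>e \<subseteq> V\<close> eq[OF _ \<open>u \<in> e\<close>] g_x by (metis subset_iff)
        qed
      qed
    qed
    have pair: "pairing_on S (E M)" if "M \<in> D'" for M
    proof -
      have "pairing_on V M" using that D by (auto simp: D'_def)
      note M = pairing_onD[OF this]
      have "\<Union>(E M) = S"
      proof (intro equalityI subsetI)
        fix v assume "v \<in> S"
        then obtain e where "e \<in> M" "v \<in> e" using M(1) unfolding S_def by blast
        with D'_S[OF that] \<open>v \<in> S\<close> show "v \<in> \<Union>(E M)"
          unfolding edge_closed_def E_def by blast
      qed (auto simp: E_def)
      moreover have "disjoint (E M)" using M(2) by (auto simp: E_def disjoint_def)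
      ultimately show ?thesis using M(3,5) by (auto simp: pairing_on_def partition_on_def E_def)
    qed
    \<comment> \<open>Being monochromatic for \<open>g B\<close> splits into a condition independent
      of \<open>B\<close>, which defines \<open>D'\<close>, and closedness of \<open>B\<close>
      within \<open>S\<close>.\<close>
    have mono_g: "{M \<in> D. monochromatic M (g B)} = {M \<in> D'. edge_closed (E M) B}" if B: "B \<subseteq> S" for B
    proof (intro set_eqI iffI)
      fix M assume "M \<in> {M \<in> D. monochromatic M (g B)}"
      then have M: "M \<in> D" and eq: "\<And>e u v. e \<in> M \<Longrightarrow> u \<in> e \<Longrightarrow> v \<in> e \<Longrightarrow> g B u = g B v"
        unfolding monochromatic_def by blast+
      have "monochromatic M (g {})"
        unfolding monochromatic_def
      proof (intro ballI)
        fix e u v assume e: "e \<in> M" "u \<in> e" "v \<in> e"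
        have "u \<in> V" "v \<in> V" using pairing_onD(1)[OF D[OF M]] e by auto
        \<comment> \<open>Recolouring \<open>y\<close> as \<open>x\<close> turns \<open>g B\<close>
          into \<open>g {}\<close>, so equal colours stay equal.\<close>
        then have "g {} w = (if g B w = y then x else g B w)" if "w = u \<or> w = v" for w
          using that B xy(1) by (auto simp: g_def S_def)
        then show "g {} u = g {} v" using eq[OF e] by simp
      qed
      moreover have "edge_closed (E M) B"
        unfolding edge_closed_def E_def
      proof (intro ballI)
        fix e assume "e \<in> {e \<in> M. e \<subseteq> S}"
        then have e: "e \<in> M" "e \<subseteq> S" by auto
        have g_y: "g B v = y \<longleftrightarrow> v \<in> B" for v using xy(1) by (auto simp: g_def)
        have "u \<in> B \<longleftrightarrow> v \<in> B" if "u \<in> e" "v \<in> e" for u v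
          using eq[OF e(1) that] g_y[of u] g_y[of v] by simp
        then show "e \<subseteq> B \<or> e \<inter> B = {}" by blast
      qed
      ultimately show "M \<in> {M \<in> D'. edge_closed (E M) B}" using M by (simp add: D'_def)
    next
      fix M assume "M \<in> {M \<in> D'. edge_closed (E M) B}"
      then have M: "M \<in> D" "M \<in> D'" "monochromatic M (g {})" "edge_closed (E M) B"
        unfolding D'_def by blast+
      have "monochromatic M (g B)"
        unfolding monochromatic_def
      proof (intro ballI)
        fix e u v assume e: "e \<in> M" "u \<in> e" "v \<in> e"
        then have "e \<subseteq> S \<or> e \<inter> S = {}" "e \<subseteq> S \<Longrightarrow> e \<subseteq> B \<or> e \<inter> B = {}"
          using D'_S[OF M(2)] M(4) by (auto simp: edge_closed_def E_def)
        then consider "e \<subseteq> B" | "e \<inter> B = {}" using B by blast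
        then show "g B u = g B v"
        proof cases
          case 1
          then show ?thesis using e by (auto simp: g_def)
        next
          case 2
          then have "u \<notin> B" "v \<notin> B" using e by auto
          moreover have "g {} u = g {} v" using M(3) e unfolding monochromatic_def by blast
          ultimately show ?thesis by (simp add: g_def)
        qed
      qed
      then show "M \<in> {M \<in> D. monochromatic M (g B)}" using M by simp
    qed
    have fib_g: "has_fibres V a (g B)" if B: "B \<subseteq> S" "card B = 2 * b" for B
      unfolding has_fibres_def
    proof
      fix i
      have "B \<subseteq> V" using B by (auto simp: S_def)
      consider "i = y" | "i = x" | "i \<noteq> x" "i \<noteq> y" by blast
      then show "card {v \<in> V. g B v = i} = 2 * a i"
      proof cases
        case 1
        then have "{v \<in> V. g B v = i} = B" using xy(1) \<open>B \<subseteq> V\<close> by (auto simp: g_def)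
        then show ?thesis using 1 B by (simp add: b_def)
      next
        case 2
        then have "{v \<in> V. g B v = i} = S - B"
          using xy(1) \<open>B \<subseteq> V\<close> by (auto simp: g_def S_def)
        then show ?thesis
          using 2 B finS cS by (simp add: card_Diff_subset finite_subset b_def N_def)
      next
        case 3
        then have "{v \<in> V. g B v = i} = {v \<in> V. f v = i}"
          using B by (auto simp: g_def S_def)
        then show ?thesis using 3 fib[of i] by simp
      qed
    qed
    \<comment> \<open>With this choice \<open>g A\<close> agrees with \<open>f\<close> on
      \<open>V\<close>, so the count for \<open>A\<close> is the one sought.\<close>
    define A where "A = {v \<in> V. f v = y}"
    have A: "A \<subseteq> S" "card A = 2 * (b - 1)" using fib[of y] xy by (auto simp: A_def S_def b_def)
    have finD': "finite D'" using finD by (simp add: D'_def)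
    have cc: "closed_count D' E B = card {M \<in> D'. edge_closed (E M) B}" for B
      by (rule closed_count_def[OF finS finD' cS]) (rule pair)
    have "monochromatic M (g A) \<longleftrightarrow> monochromatic M f" if "M \<in> D" for M
    proof -
      have "g A v = f v" if "v \<in> V" for v using that by (auto simp: g_def A_def)
      then show ?thesis
        using pairing_onD(1)[OF D[OF that]] unfolding monochromatic_def by (metis UnionI)
    qed
    then have "card {M \<in> D. monochromatic M f} = card {M \<in> D'. edge_closed (E M) A}"
      using mono_g[OF A(1)] by (metis (mono_tags, lifting) Collect_cong)
    also have "\<dots> = closed_count D' E A" by (simp add: cc)
    also have "\<dots> = ((2 * N) choose (2 * b)) * c div (N choose b) * (N choose (b - 1)) div ((2 * N) choose (2 * (b - 1)))"
    proof (rule closed_count_transfer[OF finS finD' cS])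
      show "closed_count D' E B = c" if "B \<subseteq> S" "card B = 2 * b" for B
        using mono_g[OF that(1)] c[OF fib_g[OF that]] by (simp only: cc)
    qed (use pair A xy in \<open>auto simp: b_def N_def\<close>)
    finally show ?thesis .
  qed
  then show ?thesis unfolding colour_balanced_def by blast
qed

section \<open>Dominance order as a sequence of unit moves\<close>

text \<open>The moves only raise deficient entries and lower surplus ones, so the hypothesis
  \<open>order\<close>, unlike monotonicity of \<open>a\<close>, survives each of them.\<close>

lemma dominance_induct:
  fixes a m :: "nat \<Rightarrow> nat"
  assumes move: "\<And>a i j. Q a \<Longrightarrow> i \<noteq> j \<Longrightarrow> a j \<le> a i \<Longrightarrow> 0 < a j \<Longrightarrow> Q (a(i := a i + 1, j := a j - 1))"
    and "Q a"
    and order: "\<And>i j. i < j \<Longrightarrow> a i < m i \<Longrightarrow> m j < a j \<Longrightarrow> a j \<le> a i"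
    and dom: "\<And>t. (\<Sum>k<t. a k) \<le> (\<Sum>k<t. m k)"
    and total: "(\<Sum>k<L. a k) = (\<Sum>k<L. m k)"
    and tail: "\<And>k. L \<le> k \<Longrightarrow> a k = m k"
  shows "Q m"
  using assms(2-)
\<comment> \<open>The measure is the total deficit: truncated subtraction ignores entries in
  surplus.\<close>
proof (induction "\<Sum>k<L. m k - a k" arbitrary: a rule: less_induct)
  case less
  show ?case
  proof (cases "\<exists>j. m j < a j")
    case False
    then have le: "a k \<le> m k" for k by (simp add: not_less)
    have "a k = m k" for k
    proof (cases "k < L")
      case True
      show ?thesis
      proof (rule ccontr)
        assume "a k \<noteq> m k"
        with le[of k] have "a k < m k" by simp
        with True le have "(\<Sum>k<L. a k) < (\<Sum>k<L. m k)" by (intro sum_strict_mono_ex1) auto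
        with less.prems(4) show False by simp
      qed
    qed (use less.prems(5) in auto)
    then show ?thesis using less.prems(1) by presburger
  next
    case True
    define j where "j = (LEAST j. m j < a j)"
    have j: "m j < a j" unfolding j_def using True by (rule LeastI_ex)
    have below: "a k \<le> m k" if "k < j" for k
      using not_less_Least[of k "\<lambda>j. m j < a j"] that unfolding j_def by simp
    \<comment> \<open>If no earlier entry were deficient, the surplus at \<open>j\<close> would
      violate dominance for the first \<open>j + 1\<close> entries.\<close>
    have "\<exists>i<j. a i < m i"
    proof (rule ccontr)
      assume "\<not> ?thesis"
      then have "(\<Sum>k<j. m k) \<le> (\<Sum>k<j. a k)"
        by (intro sum_mono) (simp flip: not_less)
      with j less.prems(3)[of "Suc j"] show False by simp
    qed
    then obtain i where i: "i < j" "a i < m i" by blast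
    have "j < L" using j less.prems(5)[of j] by (cases "j < L") auto
    let ?a = "a(i := a i + 1, j := a j - 1)"
    \<comment> \<open>Prefix sums grow by one exactly for \<open>i < t \<le> j\<close>; the truth
      values stand on both sides to avoid subtraction.\<close>
    have sum: "(\<Sum>k<t. ?a k) + of_bool (j < t) = (\<Sum>k<t. a k) + of_bool (i < t)" for t
    proof (induction t)
      case (Suc t)
      have "?a t + of_bool (t = j) = a t + of_bool (t = i)" using i j by auto
      with Suc.IH show ?case by (auto simp: less_Suc_eq)
    qed simp
    show ?thesis
    proof (rule less.hyps)
      show "(\<Sum>k<L. m k - ?a k) < (\<Sum>k<L. m k - a k)"
        using i j \<open>j < L\<close> by (intro sum_strict_mono_ex1) (auto intro!: bexI[of _ i])
      show "Q ?a" using less.prems(1,2) i j by (intro move) auto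
      show "?a j' \<le> ?a i'" if "i' < j'" "?a i' < m i'" "m j' < ?a j'" for i' j'
        using that less.prems(2)[of i' j'] i j by (auto split: if_splits)
      show "(\<Sum>k<t. ?a k) \<le> (\<Sum>k<t. m k)" for t
      \<comment> \<open>For \<open>i < t \<le> j\<close> the deficit at \<open>i\<close>, with no
        surplus before \<open>j\<close>, makes the old inequality strict and leaves room for the
        added unit.\<close>
      proof (cases "i < t \<and> t \<le> j")
        case True
        then have "(\<Sum>k<t. a k) < (\<Sum>k<t. m k)"
          using i below by (intro sum_strict_mono_ex1) auto
        moreover have "(\<Sum>k<t. ?a k) = Suc (\<Sum>k<t. a k)" using sum[of t] True by simp
        ultimately show ?thesis by linarith
      next
        case False
        then have "(i < t) = (j < t)" using i by auto
        with sum[of t] less.prems(3)[of t] show ?thesis by simp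
      qed
      show "(\<Sum>k<L. ?a k) = (\<Sum>k<L. m k)"
        using sum[of L] less.prems(4) i \<open>j < L\<close> by simp
      show "?a k = m k" if "L \<le> k" for k using that less.prems(5) i \<open>j < L\<close> by auto
    qed
  qed
qed

lemma sum_nth_default: "(\<Sum>k<t. nth_default 0 l k) = sum_list (take t l)"
proof -
  have "(\<Sum>k<t. nth_default 0 l k) = (\<Sum>k<min t (length l). nth_default 0 l k)"
    by (rule sum.mono_neutral_right) (auto simp: nth_default_def)
  also have "\<dots> = (\<Sum>k<min t (length l). l ! k)"
    by (rule sum.cong) (auto simp: nth_default_def)
  finally show ?thesis by (simp add: sum_list_sum_nth lessThan_atLeast0 min.commute)
qed

text \<open>The two-block move drives the dominance induction, and \<open>l\<close> being weakly
  decreasing supplies its order hypothesis. At \<open>length l + length m\<close> both lists are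
  exhausted, so both sums are \<open>n\<close> and the padded tails are 0.\<close>

lemma colour_balanced_dominated:
  assumes "finite V" "finite D" "\<And>M. M \<in> D \<Longrightarrow> pairing_on V M"
    and l: "int_partition n l" and m: "int_partition n m" and dom: "dominated_by l m"
    and "colour_balanced V D (nth_default 0 l)"
  shows "colour_balanced V D (nth_default 0 m)"
proof (rule dominance_induct[where Q = "colour_balanced V D" and a = "nth_default 0 l"
      and L = "length l + length m"])
  show "nth_default 0 l j \<le> nth_default 0 l i" if "i < j" for i j
    using l that by (auto simp: int_partition_def nth_default_def sorted_wrt_iff_nth_less)
  show "(\<Sum>k<t. nth_default 0 l k) \<le> (\<Sum>k<t. nth_default 0 m k)" for t
    using dom by (cases "t = 0") (auto simp: sum_nth_default dominated_by_def)
  show "(\<Sum>k<length l + length m. nth_default 0 l k) = (\<Sum>k<length l + length m. nth_default 0 m k)"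
    using l m by (simp add: sum_nth_default int_partition_def)
  show "colour_balanced V D (a(i := a i + 1, j := a j - 1))"
    if "colour_balanced V D a" "i \<noteq> j" "a j \<le> a i" "0 < a j" for a i j
    by (rule colour_balanced_move) (use assms(1-3) that in auto)
qed (use assms in \<open>auto simp: nth_default_def\<close>)

section \<open>Set partitions of doubled shape as colour classes\<close>

text \<open>Serves to list the blocks of a set partition with their sizes in the order of the given
  parts.\<close>

lemma image_mset_eq_mset_map:
  "image_mset f X = mset ys \<Longrightarrow> \<exists>xs. mset xs = X \<and> map f xs = ys"
proof (induction ys arbitrary: X)
  case (Cons y ys)
  then obtain X' x where "X = add_mset x X'" "f x = y" "image_mset f X' = mset ys"
    by (auto simp: msed_map_invR dest!: msed_map_invR)
  with Cons.IH[of X'] show ?case by (metis list.simps(9) mset.simps(2))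
qed auto

text \<open>No vertex has a colour beyond the list, since the padded size there is 0, and positive
  parts make the other classes non-empty. So the classes are the blocks of a set partition.\<close>

lemma fibres_double_shape:
  assumes l: "0 \<notin> set l" and f: "has_fibres {1..2 * n} (nth_default 0 l) f"
  defines "P \<equiv> (\<lambda>i. {v \<in> {1..2 * n}. f v = i}) ` {..<length l}"
  shows "has_double_shape n l P"
    and "partition_on {1..2 * n} M \<Longrightarrow> refines {1..2 * n} M P \<longleftrightarrow> monochromatic M f"
proof -
  let ?F = "\<lambda>i. {v \<in> {1..2 * n}. f v = i}"
  have card_F: "card (?F i) = 2 * nth_default 0 l i" for i using f by (auto simp: has_fibres_def)
  have pos: "0 < nth_default 0 l i" if "i < length l" for i
    using that l nth_mem[OF that] by (metis gr0I nth_default_nth)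
  have less: "f v < length l" if "v \<in> {1..2 * n}" for v
  proof (rule ccontr)
    assume "\<not> ?thesis"
    then have "?F (f v) = {}" using card_F[of "f v"] by (simp add: nth_default_def)
    with that show False by blast
  qed
  have ne: "?F i \<noteq> {}" if "i < length l" for i
    using card_F[of i] pos[OF that]
    by (metis card.empty nat_0_less_mult_iff less_numeral_extra(3) zero_less_numeral)
  \<comment> \<open>Non-empty classes of different colours are different sets, so no part is lost in
    forming \<open>P\<close> as an image.\<close>
  have inj: "inj_on ?F {..<length l}"
    using ne by (intro inj_onI) blast
  have part: "partition_on {1..2 * n} P"
    unfolding partition_on_def P_def disjoint_def using less ne by auto
  have "image_mset card (mset_set P) = image_mset (\<lambda>i. card (?F i)) (mset_set {..<length l})"
    unfolding P_def by (simp only: image_mset_mset_set[OF inj, symmetric] image_mset.compositionality o_def)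
  also have "\<dots> = mset (map (\<lambda>i. 2 * nth_default 0 l i) [0..<length l])"
    by (simp only: card_F mset_map mset_upt lessThan_atLeast0)
  also have "map (\<lambda>i. 2 * nth_default 0 l i) [0..<length l] = map (\<lambda>i. 2 * i) l"
    by (rule nth_equalityI) (auto simp: nth_default_def)
  finally show "has_double_shape n l P" using part by (simp add: has_double_shape_def)
  assume M: "partition_on {1..2 * n} M"
  have "(\<exists>p\<in>P. e \<subseteq> p) \<longleftrightarrow> (\<forall>u\<in>e. \<forall>v\<in>e. f u = f v)" if "e \<in> M" for e
  proof
    assume eq: "\<forall>u\<in>e. \<forall>v\<in>e. f u = f v"
    have "e \<noteq> {}" using partition_onD3[OF M] that by blast
    then obtain u where u: "u \<in> e" by blast
    have e: "e \<subseteq> {1..2 * n}" using partition_onD1[OF M] that by blast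
    with eq u have "e \<subseteq> ?F (f u)" by blast
    moreover have "?F (f u) \<in> P" unfolding P_def using less u e by blast
    ultimately show "\<exists>p\<in>P. e \<subseteq> p" by blast
  qed (auto simp: P_def)
  then show "refines {1..2 * n} M P \<longleftrightarrow> monochromatic M f"
    using M part by (simp add: refines_def monochromatic_def)
qed

text \<open>List the blocks with sizes in the order of \<open>l\<close> and colour each vertex by
  the position of its block.\<close>

lemma double_shape_fibres:
  assumes l: "0 \<notin> set l" and P: "has_double_shape n l P"
  obtains f where "has_fibres {1..2 * n} (nth_default 0 l) f"
    and "P = (\<lambda>i. {v \<in> {1..2 * n}. f v = i}) ` {..<length l}"
proof -
  have part: "partition_on {1..2 * n} P"
    and "image_mset card (mset_set P) = mset (map (\<lambda>i. 2 * i) l)"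
    using P by (auto simp: has_double_shape_def)
  then obtain xs where xs: "mset xs = mset_set P" "map card xs = map (\<lambda>i. 2 * i) l"
    using image_mset_eq_mset_map by metis
  have "finite P" using part finite_elements by blast
  with xs(1) have set_xs: "set xs = P" by (metis finite_set_mset_mset_set set_mset_mset)
  have dist: "distinct xs"
    using xs(1) set_xs \<open>finite P\<close> by (simp add: distinct_count_atmost_1 count_mset_set)
  have len: "length xs = length l" using xs(2) by (metis length_map)
  \<comment> \<open>The position is unique for vertices in \<open>{1..2 * n}\<close>; elsewhere the
    value is unspecified, and the fibres ignore it.\<close>
  define f where "f v = (THE i. i < length l \<and> v \<in> xs ! i)" for v
  have uniq: "i = j" if "i < length l" "j < length l" "v \<in> xs ! i" "v \<in> xs ! j" for i j v
  proof -
    have "xs ! i \<in> P" "xs ! j \<in> P" using that len set_xs by auto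
    with part that have "xs ! i = xs ! j" by (auto simp: partition_on_def disjoint_def)
    with dist that len show ?thesis by (simp add: nth_eq_iff_index_eq)
  qed
  have f: "f v < length l \<and> v \<in> xs ! f v" if "v \<in> {1..2 * n}" for v
  proof -
    have "\<exists>i. i < length l \<and> v \<in> xs ! i"
      using part that set_xs len by (metis UnionE in_set_conv_nth partition_onD1)
    then have "\<exists>!i. i < length l \<and> v \<in> xs ! i" using uniq by blast
    then show ?thesis unfolding f_def by (rule theI')
  qed
  have fib: "{v \<in> {1..2 * n}. f v = i} = xs ! i" if "i < length l" for i
  proof -
    have "xs ! i \<in> P" using that len set_xs by auto
    then have "xs ! i \<subseteq> {1..2 * n}" using part by (auto simp: partition_on_def)
    then show ?thesis using f uniq that by blast
  qed
  have "has_fibres {1..2 * n} (nth_default 0 l) f"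
    unfolding has_fibres_def
  proof
    fix i
    show "card {v \<in> {1..2 * n}. f v = i} = 2 * nth_default 0 l i"
    proof (cases "i < length l")
      case True
      then have "card (xs ! i) = 2 * l ! i" using xs(2) len by (metis nth_map)
      then show ?thesis using True by (simp only: fib nth_default_nth)
    next
      case False
      then have "{v \<in> {1..2 * n}. f v = i} = {}" using f by blast
      then show ?thesis using False by (simp only: card.empty nth_default_def) simp
    qed
  qed
  moreover have "P = (\<lambda>i. {v \<in> {1..2 * n}. f v = i}) ` {..<length l}"
  proof -
    have "P = (\<lambda>i. xs ! i) ` {..<length l}" using set_xs len by (auto simp: set_conv_nth)
    then show ?thesis using fib by auto
  qed
  ultimately show ?thesis using that by blast
qed

text \<open>Several colourings may induce the same set partition, but every partition of the shape
  arises from one, so the same constant works on both sides.\<close>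

lemma factorisation_iff_colour_balanced:
  assumes "0 \<notin> set l" "D \<noteq> {}" "D \<subseteq> perfect_matchings n"
  shows "factorisation n l D \<longleftrightarrow> colour_balanced {1..2 * n} D (nth_default 0 l)"
proof -
  have part: "partition_on {1..2 * n} M" if "M \<in> D" for M
    using that assms(3) by (auto simp: perfect_matchings_def)
  let ?P = "\<lambda>f. (\<lambda>i. {v \<in> {1..2 * n}. f v = i}) ` {..<length l}"
  have eq: "{M \<in> D. refines {1..2 * n} M (?P f)} = {M \<in> D. monochromatic M f}"
    if "has_fibres {1..2 * n} (nth_default 0 l) f" for f
    using fibres_double_shape(2)[OF assms(1) that] part by blast
  have "(\<forall>P. has_double_shape n l P \<longrightarrow> card {M \<in> D. refines {1..2 * n} M P} = c)
    \<longleftrightarrow> (\<forall>f. has_fibres {1..2 * n} (nth_default 0 l) f \<longrightarrow> card {M \<in> D. monochromatic M f} = c)" for c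
  proof (intro iffI allI impI)
    fix f
    assume all: "\<forall>P. has_double_shape n l P \<longrightarrow> card {M \<in> D. refines {1..2 * n} M P} = c"
      and f: "has_fibres {1..2 * n} (nth_default 0 l) f"
    show "card {M \<in> D. monochromatic M f} = c"
      using all[rule_format, OF fibres_double_shape(1)[OF assms(1) f]] by (simp only: eq[OF f])
  next
    fix P
    assume all: "\<forall>f. has_fibres {1..2 * n} (nth_default 0 l) f \<longrightarrow> card {M \<in> D. monochromatic M f} = c"
      and "has_double_shape n l P"
    then obtain f where f: "has_fibres {1..2 * n} (nth_default 0 l) f" and P: "P = ?P f"
      using double_shape_fibres[OF assms(1)] by blast
    show "card {M \<in> D. refines {1..2 * n} M P} = c"
      unfolding P eq[OF f] using all f by blast
  qed
  then show ?thesis using assms(2,3) by (simp add: factorisation_def colour_balanced_def)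
qed

theorem mainTheorem3:
  fixes n :: nat and l m :: "nat list" and D :: "nat set set set"
  assumes "n \<ge> 1"
    and "int_partition n l" and "int_partition n m"
    and "D \<noteq> {}" and "D \<subseteq> perfect_matchings n"
    and "factorisation n l D"
    and "dominated_by l m"
  shows "factorisation n m D"
proof -
  have pairing: "pairing_on {1..2 * n} M" if "M \<in> D" for M
    using assms(5) that by (auto simp: perfect_matchings_def pairing_on_def)
  have "D \<subseteq> Pow (Pow {1..2 * n})"
    using pairing pairing_onD(1) by blast
  then have "finite D" by (rule finite_subset) simp
  moreover have "0 \<notin> set l" "0 \<notin> set m" using assms(2,3) by (auto simp: int_partition_def)
  ultimately show ?thesis
    using assms colour_balanced_dominated[of "{1..2 * n}" D n l m] pairing
    by (simp add: factorisation_iff_colour_balanced)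
qed

end
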